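(* Let $A=M_n(\mathbb{C})$, let $\psi$ be a state on $A$, let $a_1,a_2\in A_{sa}$, let $\Delta_1,\Delta_2\subseteq\mathbb{R}$ be open, and let $C\in\mathcal{C}$. If $\underline{[a\in\Delta]}$ is defined using $\delta^{i}(\chi_{\Delta}(a))$, then the following two conditions are equivalent in the covariant model: 1. $C\Vdash\underline{\mu}(\underline{[a_{1}\in\Delta_{1}]}\wedge\underline{[a_{2}\in\Delta_{2}]})=\underline{1}$; 2. There exists $p\in\mathrm{Proj}(C)$ such that $p\leq\chi_{\Delta_{1}}(a_{1})$, $p\leq\chi_{\Delta_{2}}(a_{2})$, and $\psi(p)=1$.
   Context: Covariant model: $\mathcal{C}$ is the poset (under inclusion) of abelian von Neumann subalgebras of $A$ (containing the unit of $A$); the topos is $[\mathcal{C},\mathbf{Set}]$. $\Sigma_C$ is the Gelfand spectrum of $C$. $\Sigma_{\uparrow}=\coprod_C\Sigma_C$ with $U$ open iff (1) if $\lambda\in U_D$, $D\subseteq C$, $\lambda'\in\Sigma_C$ and $\lambda'|_D=\lambda$, then $\lambda'\in U_C$, and (2) $U_C:=U\cap\Sigma_C$ is open in $\Sigma_C$ for all $C$. $\mathcal{O}\Sigma_{\uparrow}$ is a complete Heyting algebra under inclusion, and the connective $\wedge$ is taken in it. For a projection $p\in A$, $\delta^i(p)_C=\bigvee\{q\in\mathrm{Proj}(C)\mid q\leq p\}$. The elementary proposition $\underline{[a\in\Delta]}$ is (externally) the open $[a\in\Delta]=\{(C,\lambda)\in\Sigma_{\uparrow}\mid\lambda(\delta^i(\chi_\Delta(a))_C)=1\}$,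 where $\chi_\Delta(a)$ is the spectral projection. $\underline{\mu}$ is the internal probability valuation (on the internal locale described by $\Sigma_{\uparrow}$) associated to $\psi$: externally $\mu(U)(C)=\mu^{C}(U_C)$ for $U\in\mathcal{O}\Sigma_{\uparrow}$, with $\mu^C:\mathcal{O}\Sigma_C\to[0,1]$ the probability valuation corresponding to $\psi|_C$ by Riesz–Markov (so if $U_C$ is the clopen set corresponding to the projection $p_C\in C$, then $\mu(U)(C)=\psi(p_C)$). By (co)presheaf semantics, $C\Vdash\underline{\mu}(\underline{U})=\underline{1}$ means $\mu(U)(E)=1$ for all $E\in\mathcal{C}$ with $E\supseteq C$. *)

theory Defs
  imports "HOL-Analysis.Analysis" "HOL-Probability.Probability"
begin

section \<open>The C*-algebra of complex matrices\<close>

type_synonym 'n cmat = "complex ^ 'n ^ 'n"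

definition cscale :: "complex \<Rightarrow> 'n cmat \<Rightarrow> 'n::finite cmat" where
  "cscale c x = map_matrix ((*) c) x"

definition adj :: "'n cmat \<Rightarrow> 'n::finite cmat" where
  "adj x = map_matrix cnj (transpose x)"

definition selfadjoint :: "'n::finite cmat \<Rightarrow> bool" where
  "selfadjoint x \<longleftrightarrow> adj x = x"

definition positive_elt :: "'n::finite cmat \<Rightarrow> bool" where
  "positive_elt x \<longleftrightarrow> (\<exists>b. x = adj b ** b)"

definition cmat_le :: "'n::finite cmat \<Rightarrow> 'n cmat \<Rightarrow> bool"  (infix \<open>\<preceq>\<close> 50) where
  "x \<preceq> y \<longleftrightarrow> selfadjoint x \<and> selfadjoint y \<and> positive_elt (y - x)"

definition is_projection :: "'n::finite cmat \<Rightarrow> bool" where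
  "is_projection p \<longleftrightarrow> selfadjoint p \<and> p ** p = p"

definition clinear_on :: "'n::finite cmat set \<Rightarrow> ('n cmat \<Rightarrow> complex) \<Rightarrow> bool" where
  "clinear_on C f \<longleftrightarrow>
     (\<forall>x\<in>C. \<forall>y\<in>C. f (x + y) = f x + f y) \<and> (\<forall>c. \<forall>x\<in>C. f (cscale c x) = c * f x)"

definition is_state :: "('n::finite cmat \<Rightarrow> complex) \<Rightarrow> bool" where
  "is_state \<psi> \<longleftrightarrow>
     clinear_on UNIV \<psi> \<and> (\<forall>x. positive_elt x \<longrightarrow> \<psi> x \<in> \<real>\<^sub>\<ge>\<^sub>0) \<and> \<psi> (mat 1) = 1"


section \<open>Spectral projections\<close>

definition eigenspace :: "'n::finite cmat \<Rightarrow> real \<Rightarrow> (complex ^ 'n) set" where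
  "eigenspace a t = {v. a *v v = complex_of_real t *s v}"

definition real_spectrum :: "'n::finite cmat \<Rightarrow> real set" where
  "real_spectrum a = {t. eigenspace a t \<noteq> {0}}"

definition eigenprojection :: "'n::finite cmat \<Rightarrow> real \<Rightarrow> 'n cmat" where
  "eigenprojection a t = (THE p. is_projection p \<and> range ((*v) p) = eigenspace a t)"

text \<open>
  Functional calculus of a self-adjoint matrix: \<open>f(a)\<close> is the sum of \<open>f(t) E\<^sub>t\<close> over the
  (finite, real) spectrum of \<open>a\<close>, where \<open>a\<close> itself is the sum of the \<open>t E\<^sub>t\<close>.
\<close>

definition functional_calculus :: "(real \<Rightarrow> real) \<Rightarrow> 'n::finite cmat \<Rightarrow> 'n cmat" where
  "functional_calculus f a = (\<Sum>t\<in>real_spectrum a. f t *\<^sub>R eigenprojection a t)"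

definition spectral_projection :: "real set \<Rightarrow> 'n::finite cmat \<Rightarrow> 'n cmat"  (\<open>\<chi>\<^sub>s\<^sub>p\<close>) where
  "\<chi>\<^sub>s\<^sub>p \<Delta> a = functional_calculus (indicator \<Delta>) a"


section \<open>The poset of contexts\<close>

definition commutant :: "'n::finite cmat set \<Rightarrow> 'n cmat set" where
  "commutant S = {x. \<forall>y\<in>S. x ** y = y ** x}"

definition unital_star_subalgebra :: "'n::finite cmat set \<Rightarrow> bool" where
  "unital_star_subalgebra C \<longleftrightarrow>
     mat 1 \<in> C \<and> (\<forall>x\<in>C. \<forall>y\<in>C. x + y \<in> C \<and> x ** y \<in> C) \<and>
     (\<forall>c. \<forall>x\<in>C. cscale c x \<in> C) \<and> (\<forall>x\<in>C. adj x \<in> C)"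

definition von_neumann_subalgebra :: "'n::finite cmat set \<Rightarrow> bool" where
  "von_neumann_subalgebra C \<longleftrightarrow> unital_star_subalgebra C \<and> commutant (commutant C) = C"

definition contexts :: "'n::finite cmat set set" where
  "contexts = {C. von_neumann_subalgebra C \<and> (\<forall>x\<in>C. \<forall>y\<in>C. x ** y = y ** x)}"

definition Proj :: "'n::finite cmat set \<Rightarrow> 'n cmat set" where
  "Proj C = {p \<in> C. is_projection p}"

definition Proj_Sup :: "'n::finite cmat set \<Rightarrow> 'n cmat set \<Rightarrow> 'n cmat" where
  "Proj_Sup C Q = (THE r. r \<in> Proj C \<and> (\<forall>q\<in>Q. q \<preceq> r) \<and>
     (\<forall>s\<in>Proj C. (\<forall>q\<in>Q. q \<preceq> s) \<longrightarrow> r \<preceq> s))"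

definition inner_daseinisation :: "'n::finite cmat \<Rightarrow> 'n cmat set \<Rightarrow> 'n cmat"  (\<open>\<delta>\<^sup>i\<close>) where
  "\<delta>\<^sup>i p C = Proj_Sup C {q \<in> Proj C. q \<preceq> p}"


section \<open>The spectral bundle\<close>

text \<open>
  A character of \<open>C\<close> is represented by a function on all matrices that is \<open>undefined\<close> outside \<open>C\<close>.
\<close>

definition gelfand_spectrum :: "'n::finite cmat set \<Rightarrow> ('n cmat \<Rightarrow> complex) set"  (\<open>\<Sigma>\<^sub>G\<close>) where
  "\<Sigma>\<^sub>G C = {l \<in> extensional C. clinear_on C l \<and>
     (\<forall>x\<in>C. \<forall>y\<in>C. l (x ** y) = l x * l y) \<and> (\<exists>x\<in>C. l x \<noteq> 0)}"

text \<open>The weak-* topology, i.e. pointwise convergence on \<open>C\<close>.\<close>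

definition gelfand_topology :: "'n::finite cmat set \<Rightarrow> ('n cmat \<Rightarrow> complex) topology" where
  "gelfand_topology C = subtopology (product_topology (\<lambda>_. euclidean) C) (\<Sigma>\<^sub>G C)"

lemma topspace_gelfand_topology [simp]: "topspace (gelfand_topology C) = \<Sigma>\<^sub>G C"
  by (auto simp: gelfand_topology_def gelfand_spectrum_def PiE_def)

definition Sigma_up :: "('n::finite cmat set \<times> ('n cmat \<Rightarrow> complex)) set" where
  "Sigma_up = Sigma contexts gelfand_spectrum"

abbreviation fibre :: "('a \<times> 'b) set \<Rightarrow> 'a \<Rightarrow> 'b set" where
  "fibre U C \<equiv> U `` {C}"

definition Sigma_up_open :: "('n::finite cmat set \<times> ('n cmat \<Rightarrow> complex)) set \<Rightarrow> bool" where
  "Sigma_up_open U \<longleftrightarrow> U \<subseteq> Sigma_up \<and>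
     (\<forall>D\<in>contexts. \<forall>C\<in>contexts. \<forall>l\<in>fibre U D. \<forall>l'\<in>\<Sigma>\<^sub>G C.
        D \<subseteq> C \<and> restrict l' D = l \<longrightarrow> l' \<in> fibre U C) \<and>
     (\<forall>C\<in>contexts. openin (gelfand_topology C) (fibre U C))"

definition Sigma_up_topology :: "('n::finite cmat set \<times> ('n cmat \<Rightarrow> complex)) topology" where
  "Sigma_up_topology = topology Sigma_up_open"

lemma istopology_Sigma_up_open: "istopology Sigma_up_open"
  unfolding istopology_def
proof (intro conjI allI impI)
  fix S T :: "('n::finite cmat set \<times> ('n cmat \<Rightarrow> complex)) set"
  assume S: "Sigma_up_open S" and T: "Sigma_up_open T"
  have eq: "fibre (S \<inter> T) C = fibre S C \<inter> fibre T C" for C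
    by blast
  have "S \<inter> T \<subseteq> Sigma_up"
    using S unfolding Sigma_up_open_def by blast
  moreover have "openin (gelfand_topology C) (fibre (S \<inter> T) C)" if "C \<in> contexts" for C
    unfolding eq
  proof (rule openin_Int)
    show "openin (gelfand_topology C) (fibre S C)" "openin (gelfand_topology C) (fibre T C)"
      using S T that unfolding Sigma_up_open_def by simp_all
  qed
  moreover have "l' \<in> fibre (S \<inter> T) C"
    if h: "D \<in> contexts" "C \<in> contexts" "l \<in> fibre (S \<inter> T) D" "l' \<in> \<Sigma>\<^sub>G C"
      "D \<subseteq> C \<and> restrict l' D = l" for C D l l'
  proof -
    have "l \<in> fibre S D" "l \<in> fibre T D"
      using h(3) unfolding eq by simp_all
    then have "l' \<in> fibre S C" "l' \<in> fibre T C"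
      using S T h(1,2,4,5) unfolding Sigma_up_open_def by metis+
    then show ?thesis
      unfolding eq by simp
  qed
  ultimately show "Sigma_up_open (S \<inter> T)"
    unfolding Sigma_up_open_def by blast
next
  fix K :: "('n::finite cmat set \<times> ('n cmat \<Rightarrow> complex)) set set"
  assume K: "\<forall>S\<in>K. Sigma_up_open S"
  have eq: "fibre (\<Union>K) C = (\<Union>S\<in>K. fibre S C)" for C
    by auto
  have "openin (gelfand_topology C) (fibre (\<Union>K) C)" if "C \<in> contexts" for C
    unfolding eq
  proof (rule openin_Union, clarify)
    fix S assume "S \<in> K"
    then show "openin (gelfand_topology C) (fibre S C)"
      using K that unfolding Sigma_up_open_def by blast
  qed
  moreover have "\<Union>K \<subseteq> Sigma_up"
    using K unfolding Sigma_up_open_def by blast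
  moreover have "l' \<in> fibre (\<Union>K) C"
    if h: "D \<in> contexts" "C \<in> contexts" "l \<in> fibre (\<Union>K) D" "l' \<in> \<Sigma>\<^sub>G C"
      "D \<subseteq> C \<and> restrict l' D = l" for C D l l'
  proof -
    obtain S where S: "S \<in> K" "l \<in> fibre S D"
      using h(3) unfolding eq by blast
    have "Sigma_up_open S"
      using K S(1) by blast
    then have "l' \<in> fibre S C"
      using h(1,2,4,5) S(2) unfolding Sigma_up_open_def by metis
    then show ?thesis
      using S(1) unfolding eq by blast
  qed
  ultimately show "Sigma_up_open (\<Union>K)"
    unfolding Sigma_up_open_def by blast
qed

lemma openin_Sigma_up_topology: "openin Sigma_up_topology U \<longleftrightarrow> Sigma_up_open U"
  by (simp add: Sigma_up_topology_def istopology_Sigma_up_open topology_inverse')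

text \<open>
  The meet in the complete Heyting algebra of opens, as the largest open lower bound; on opens
  it is the intersection.
\<close>

definition open_meet :: "'a topology \<Rightarrow> 'a set \<Rightarrow> 'a set \<Rightarrow> 'a set" where
  "open_meet X U V = \<Union>{W. openin X W \<and> W \<subseteq> U \<and> W \<subseteq> V}"

lemma open_meet_eq_Int: "openin X U \<Longrightarrow> openin X V \<Longrightarrow> open_meet X U V = U \<inter> V"
  unfolding open_meet_def using openin_Int[of X U V] by blast

definition elementary_proposition ::
    "'n::finite cmat \<Rightarrow> real set \<Rightarrow> ('n cmat set \<times> ('n cmat \<Rightarrow> complex)) set"  (\<open>[_ \<in>\<in> _]\<close>) where
  "[a \<in>\<in> \<Delta>] = {(C, l) \<in> Sigma_up. l (\<delta>\<^sup>i (\<chi>\<^sub>s\<^sub>p \<Delta> a) C) = 1}"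


section \<open>The internal valuation of a state\<close>

text \<open>
  The measure representing the restriction of \<open>\<psi>\<close> to \<open>C\<close> by Riesz-Markov. No regularity condition
  is needed: the spectrum of \<open>C\<close> is compact and metrizable, so all Borel probability measures on it
  are regular.
\<close>

definition riesz_measure ::
    "('n::finite cmat \<Rightarrow> complex) \<Rightarrow> 'n cmat set \<Rightarrow> ('n cmat \<Rightarrow> complex) measure" where
  "riesz_measure \<psi> C = (THE M. prob_space M \<and> space M = \<Sigma>\<^sub>G C \<and>
     sets M = sigma_sets (\<Sigma>\<^sub>G C) {U. openin (gelfand_topology C) U} \<and>
     (\<forall>c\<in>C. has_bochner_integral M (\<lambda>l. l c) (\<psi> c)))"

definition internal_valuation ::
    "('n::finite cmat \<Rightarrow> complex) \<Rightarrow> ('n cmat set \<times> ('n cmat \<Rightarrow> complex)) set \<Rightarrow> 'n cmat set \<Rightarrow> real"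
  where
  "internal_valuation \<psi> U C = measure (riesz_measure \<psi> C) (fibre U C)"

text \<open>Copresheaf semantics of \<open>C \<tturnstile> \<mu>(U) = 1\<close>.\<close>

definition forces_valuation_one ::
    "'n::finite cmat set \<Rightarrow> ('n cmat \<Rightarrow> complex) \<Rightarrow> ('n cmat set \<times> ('n cmat \<Rightarrow> complex)) set \<Rightarrow> bool"
  where
  "forces_valuation_one C \<psi> U \<longleftrightarrow>
     (\<forall>E\<in>contexts. C \<subseteq> E \<longrightarrow> internal_valuation \<psi> U E = 1)"

end

theory Submission
  imports Defs
begin

text \<open>
  The two elementary propositions are open, so their meet has the fibre
  \<open>{l. l (d\<^sub>1) = 1 \<and> l (d\<^sub>2) = 1} = {l. l (d\<^sub>1 d\<^sub>2) = 1}\<close> over \<open>E\<close>, where \<open>d\<^sub>j\<close> is the inner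
  daseinisation of the \<open>j\<close>-th spectral projection in \<open>E\<close>. The measure of this set is the integral of
  the Gelfand transform of \<open>d\<^sub>1 d\<^sub>2\<close>, that is \<open>\<psi> (d\<^sub>1 d\<^sub>2)\<close>. Over \<open>C\<close> itself the product \<open>d\<^sub>1 d\<^sub>2\<close> is the
  required projection \<open>p\<close>; conversely any such \<open>p\<close> lies below \<open>d\<^sub>1 d\<^sub>2\<close> in every larger context.
  The Riesz-Markov measure exists and is unique because the spectrum of a context is finite: its
  points correspond to the minimal projections, on each of which the context acts by scalars.
\<close>


section \<open>Matrix algebra\<close>

lemma adj_nth: "adj x $ i $ j = cnj (x $ j $ i)"
  by (simp add: adj_def map_matrix_def transpose_def)

lemma cscale_nth: "cscale c x $ i $ j = c * x $ i $ j"
  by (simp add: cscale_def map_matrix_def)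

lemma adj_adj [simp]: "adj (adj x) = x"
  by (simp add: vec_eq_iff adj_nth)

lemma adj_add: "adj (x + y) = adj x + adj y"
  by (simp add: vec_eq_iff adj_nth)

lemma adj_diff: "adj (x - y) = adj x - adj y"
  by (simp add: vec_eq_iff adj_nth)

lemma adj_mult: "adj (x ** y) = adj y ** adj x"
  by (simp add: vec_eq_iff adj_nth matrix_matrix_mult_def mult.commute)

lemma adj_zero [simp]: "adj 0 = 0"
  by (simp add: vec_eq_iff adj_nth)

lemma adj_one [simp]: "adj (mat 1) = mat 1"
  by (simp add: vec_eq_iff adj_nth mat_def)

lemma cscale_minus_one: "cscale (- 1) x = - x"
  by (simp add: vec_eq_iff cscale_nth)

lemma cscale_one: "cscale 1 x = x"
  by (simp add: vec_eq_iff cscale_nth)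

lemma cscale_zero_right [simp]: "cscale c 0 = 0"
  by (simp add: vec_eq_iff cscale_nth)

lemma cscale_cscale: "cscale c (cscale d x) = cscale (c * d) x"
  by (simp add: vec_eq_iff cscale_nth)

lemma cscale_add_left: "cscale (c + d) x = cscale c x + cscale d x"
  by (simp add: vec_eq_iff cscale_nth algebra_simps)

lemma cscale_mult_left: "cscale c x ** y = cscale c (x ** y)"
  by (simp add: vec_eq_iff cscale_nth matrix_matrix_mult_def sum_distrib_left mult_ac)

lemma cscale_mult_right: "x ** cscale c y = cscale c (x ** y)"
  by (simp add: vec_eq_iff cscale_nth matrix_matrix_mult_def sum_distrib_left mult_ac)

lemma cscale_mult_vector: "cscale c x *v v = c *s (x *v v)"
  by (simp add: vec_eq_iff cscale_nth matrix_vector_mult_def sum_distrib_left mult_ac)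

lemma cscale_eq_0_iff: "cscale c x = 0 \<longleftrightarrow> c = 0 \<or> x = 0"
  by (auto simp: vec_eq_iff cscale_nth)

lemma matrix_mult_diff_right: "(x::'n::finite cmat) ** (y - z) = x ** y - x ** z"
  by (simp add: vec_eq_iff matrix_matrix_mult_def right_diff_distrib sum_subtractf)

lemma matrix_mult_diff_left: "(y - z) ** (x::'n::finite cmat) = y ** x - z ** x"
  by (simp add: vec_eq_iff matrix_matrix_mult_def left_diff_distrib sum_subtractf)

lemma matrix_mult_add_left: "(y + z) ** (x::'n::finite cmat) = y ** x + z ** x"
  by (simp add: vec_eq_iff matrix_matrix_mult_def distrib_right sum.distrib)

lemma matrix_mult_sum_right: "(x::'n::finite cmat) ** (\<Sum>i\<in>I. f i) = (\<Sum>i\<in>I. x ** f i)"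
  by (induction I rule: infinite_finite_induct) (simp_all add: matrix_add_ldistrib)

lemma cmat_eqI: "(\<And>v. x *v v = y *v v) \<Longrightarrow> x = (y::complex^'m::finite^'n::finite)"
  by (simp add: matrix_eq)

section \<open>The real inner product on complex vectors and its adjoint\<close>

lemma scaleR_eq_smult: "r *\<^sub>R v = complex_of_real r *s (v::complex^'n)"
  unfolding vec_eq_iff vector_scaleR_component by (simp add: scaleR_conv_of_real)

lemma inner_smult: "(c *s v) \<bullet> w = v \<bullet> (cnj c *s (w::complex^'n::finite))"
  by (simp add: inner_vec_def inner_complex_def algebra_simps)

text \<open>The inner product here is the real part of the Hermitian form. Multiplication by a
  complex number has multiplication by its conjugate as adjoint for it, so \<open>adj\<close> is
  also the adjoint in the real sense and real Euclidean geometry applies to complex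
  matrices.\<close>

lemma inner_adj: "(x *v v) \<bullet> w = v \<bullet> (adj x *v (w::complex^'n::finite))"
proof -
  have *: "(a * b) \<bullet> c = b \<bullet> (cnj a * c)" for a b c :: complex
    by (simp add: inner_complex_def algebra_simps)
  have "(x *v v) \<bullet> w = (\<Sum>i\<in>UNIV. \<Sum>j\<in>UNIV. (x $ i $ j * v $ j) \<bullet> w $ i)"
    by (simp add: inner_vec_def matrix_vector_mult_def inner_sum_left)
  also have "\<dots> = (\<Sum>j\<in>UNIV. \<Sum>i\<in>UNIV. v $ j \<bullet> (cnj (x $ i $ j) * w $ i))"
    unfolding * by (rule sum.swap)
  also have "\<dots> = v \<bullet> (adj x *v w)"
    by (simp add: inner_vec_def matrix_vector_mult_def inner_sum_right adj_nth)
  finally show ?thesis .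
qed

lemma inner_selfadjoint: "selfadjoint x \<Longrightarrow> (x *v v) \<bullet> w = v \<bullet> (x *v w)"
  by (metis inner_adj selfadjoint_def)

text \<open>The real inner product is already nondegenerate, so symmetry with respect to it forces
  \<open>adj x = x\<close>.\<close>

lemma selfadjointI:
  assumes "\<And>v w. (x *v v) \<bullet> w = v \<bullet> (x *v w)"
  shows "selfadjoint x"
proof -
  have "v \<bullet> (adj x *v w) = v \<bullet> (x *v w)" for v w
    using assms by (simp add: inner_adj)
  then have "adj x *v w = x *v w" for w
    using vector_eq_ldot by blast
  then show ?thesis
    unfolding selfadjoint_def by (rule cmat_eqI)
qed

lemma cmat_eq_0I:
  assumes "\<And>v w. w \<bullet> (x *v v) = 0"
  shows "x = (0::'n::finite cmat)"
  by (rule cmat_eqI) (metis assms inner_eq_zero_iff matrix_vector_mult_0)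


section \<open>Projections\<close>

lemma is_projection_zero [simp]: "is_projection 0"
  by (simp add: is_projection_def selfadjoint_def)

lemma is_projection_one [simp]: "is_projection (mat 1)"
  by (simp add: is_projection_def selfadjoint_def)

lemma projection_fix: "is_projection p \<Longrightarrow> v \<in> range ((*v) p) \<longleftrightarrow> p *v v = v"
  by (auto simp: is_projection_def matrix_vector_mul_assoc) (metis rangeI)

text \<open>A projection fixes exactly the vectors of its range. This turns algebraic absorption
  into inclusion of ranges, the form in which most order arguments below are carried out.\<close>

lemma projection_absorb_iff:
  assumes "is_projection p"
  shows "p ** (x::'n::finite cmat) = x \<longleftrightarrow> range ((*v) x) \<subseteq> range ((*v) p)"
proof
  assume "p ** x = x"
  then show "range ((*v) x) \<subseteq> range ((*v) p)"
    by (metis (no_types, lifting) image_subsetI matrix_vector_mul_assoc rangeI)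
next
  assume "range ((*v) x) \<subseteq> range ((*v) p)"
  then have "p *v (x *v v) = x *v v" for v
    using projection_fix[OF assms] by blast
  then show "p ** x = x"
    by (intro cmat_eqI) (simp add: matrix_vector_mul_assoc)
qed

lemma projection_absorb_commute:
  assumes "selfadjoint p" "selfadjoint q"
  shows "p ** q = q \<longleftrightarrow> q ** p = q"
  using assms by (metis adj_mult selfadjoint_def)

lemma projection_positive: "is_projection p \<Longrightarrow> positive_elt p"
  unfolding is_projection_def positive_elt_def selfadjoint_def by metis

lemma is_projection_diff:
  assumes "is_projection p" "is_projection q" "p ** q = q"
  shows "is_projection (p - q)"
  using assms projection_absorb_commute[of p q]
  by (auto simp: is_projection_def selfadjoint_def adj_diff matrix_mult_diff_left matrix_mult_diff_right)

lemma is_projection_mult: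
  assumes "is_projection p" "is_projection q" "p ** q = q ** p"
  shows "is_projection (p ** q)"
  using assms unfolding is_projection_def selfadjoint_def
  by (metis adj_mult matrix_mul_assoc)

text \<open>If \<open>p - q\<close> is positive and \<open>p *v w = 0\<close>, the form of
  \<open>p - q\<close> at \<open>w\<close> is minus the squared norm of \<open>q *v w\<close>; hence
  \<open>q\<close> vanishes on the kernel of \<open>p\<close>, which contains every
  \<open>v - p *v v\<close>. Conversely, absorption makes \<open>p - q\<close> a projection, and
  projections are positive.\<close>

lemma projection_le_iff:
  assumes p: "is_projection p" and q: "is_projection q"
  shows "q \<preceq> p \<longleftrightarrow> p ** q = q"
proof
  assume "q \<preceq> p"
  then obtain b where b: "p - q = adj b ** b"
    by (auto simp: cmat_le_def positive_elt_def)
  have "q *v (v - p *v v) = 0" for v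
  proof -
    let ?w = "v - p *v v"
    have pw: "p *v ?w = 0"
      using p by (simp add: is_projection_def matrix_vector_mult_diff_distrib matrix_vector_mul_assoc)
    have "0 \<le> (b *v ?w) \<bullet> (b *v ?w)"
      by simp
    also have "\<dots> = ?w \<bullet> ((p - q) *v ?w)"
      by (simp add: inner_adj b matrix_vector_mul_assoc)
    also have "\<dots> = - (?w \<bullet> (q *v ?w))"
      unfolding matrix_vector_mult_diff_rdistrib pw by simp
    also have "q *v ?w = q *v (q *v ?w)"
      using q by (simp add: is_projection_def matrix_vector_mul_assoc)
    also have "?w \<bullet> \<dots> = (q *v ?w) \<bullet> (q *v ?w)"
      using q by (simp add: inner_selfadjoint is_projection_def)
    finally show ?thesis
      by (metis inner_ge_zero inner_eq_zero_iff neg_0_le_iff_le order_antisym)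
  qed
  then have "q ** p = q"
    by (intro cmat_eqI) (simp add: matrix_vector_mult_diff_distrib matrix_vector_mul_assoc)
  then show "p ** q = q"
    using p q projection_absorb_commute by (auto simp: is_projection_def)
next
  assume "p ** q = q"
  then show "q \<preceq> p"
    using p q is_projection_diff[OF p q] projection_positive
    by (auto simp: cmat_le_def is_projection_def)
qed

lemma projection_le_iff_range:
  assumes "is_projection p" "is_projection q"
  shows "q \<preceq> p \<longleftrightarrow> range ((*v) q) \<subseteq> range ((*v) p)"
  using assms by (simp add: projection_le_iff projection_absorb_iff)

lemma projection_le_antisym:
  assumes "is_projection p" "is_projection q" "p \<preceq> q" "q \<preceq> p"
  shows "p = q"
  using assms projection_absorb_commute[of p q] by (simp add: projection_le_iff is_projection_def)

lemma is_projection_sum: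
  assumes "\<And>i. i \<in> I \<Longrightarrow> is_projection (f i)"
    and "\<And>i j. i \<in> I \<Longrightarrow> j \<in> I \<Longrightarrow> i \<noteq> j \<Longrightarrow> f i ** f j = 0"
  shows "is_projection (\<Sum>i\<in>I. f i)"
  using assms
\<comment> \<open>A sum over an infinite index set is 0 by convention, and 0 is a projection; this
  case and the empty one fall to the closing \<open>simp_all\<close>.\<close>
proof (induction I rule: infinite_finite_induct)
  case (insert k I)
  let ?s = "\<Sum>i\<in>I. f i"
  have s: "is_projection ?s"
    using insert by blast
  have k: "is_projection (f k)"
    using insert.prems by simp
  have 0: "f k ** ?s = 0"
    unfolding matrix_mult_sum_right using insert.prems insert.hyps by (intro sum.neutral) blast
  then have "?s ** f k = 0"
    using s k by (metis adj_mult adj_zero is_projection_def selfadjoint_def)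
  with 0 s k show ?case
    unfolding sum.insert[OF insert.hyps(1,2)]
    by (simp add: is_projection_def selfadjoint_def adj_add matrix_mult_add_left matrix_add_ldistrib)
qed simp_all

section \<open>Orthogonal projection onto a complex subspace\<close>

lemma csubspace_imp_subspace: "vec.subspace V \<Longrightarrow> subspace (V :: (complex^'n) set)"
  by (auto simp: vec.subspace_def subspace_def scaleR_eq_smult)

text \<open>A complex subspace is a real one, so real orthogonal decomposition gives each
  \<open>v\<close> a component \<open>f v\<close> in \<open>V\<close>. That component is unique, and
  uniqueness yields complex linearity of \<open>f\<close> as well as \<open>f v = v\<close> on
  \<open>V\<close>; the projection is the matrix of \<open>f\<close>.\<close>

lemma projection_onto_exists:
  fixes V :: "(complex^'n::finite) set"
  assumes V: "vec.subspace V"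
  obtains p where "is_projection p" "range ((*v) p) = V"
proof -
  have sV: "subspace V"
    by (rule csubspace_imp_subspace[OF V])
  have "\<exists>y\<in>V. \<forall>w\<in>V. (v - y) \<bullet> w = 0" for v
  proof -
    obtain y z where "y \<in> span V" "\<And>w. w \<in> span V \<Longrightarrow> orthogonal z w" "v = y + z"
      using orthogonal_subspace_decomp_exists[of V v] by metis
    moreover have "span V = V"
      using sV by (simp add: span_eq_iff)
    ultimately show ?thesis
      by (intro bexI[of _ y]) (auto simp: orthogonal_def)
  qed
  then obtain f where fV: "\<And>v. f v \<in> V" and fo: "\<And>v w. w \<in> V \<Longrightarrow> (v - f v) \<bullet> w = 0"
    by metis
  have uniq: "f v = y" if "y \<in> V" "\<And>w. w \<in> V \<Longrightarrow> (v - y) \<bullet> w = 0" for v y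
  proof -
    have d: "f v - y \<in> V"
      using sV fV that(1) by (simp add: subspace_diff)
    have "(f v - y) \<bullet> (f v - y) = (v - y) \<bullet> (f v - y) - (v - f v) \<bullet> (f v - y)"
      by (simp add: algebra_simps)
    also have "\<dots> = 0"
      using that(2)[OF d] fo[OF d] by simp
    finally show ?thesis by simp
  qed
  have "Vector_Spaces.linear (*s) (*s) f"
  proof (intro Vector_Spaces.linear_iff[THEN iffD2] conjI allI)
    show "f (v + w) = f v + f w" for v w
    proof (rule uniq)
      show "f v + f w \<in> V" using sV fV by (simp add: subspace_add)
      show "(v + w - (f v + f w)) \<bullet> u = 0" if "u \<in> V" for u
        using fo[OF that, of v] fo[OF that, of w] by (simp add: algebra_simps)
    qed
    show "f (c *s v) = c *s f v" for c v
    proof (rule uniq)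
      show "c *s f v \<in> V" using V fV by (simp add: vec.subspace_scale)
      \<comment> \<open>The scalar \<open>c\<close> crosses the inner product as
        \<open>cnj c\<close>, and \<open>cnj c *s u\<close> stays in \<open>V\<close> because
        \<open>V\<close> is closed under complex scalars.\<close>
      show "(c *s v - c *s f v) \<bullet> u = 0" if "u \<in> V" for u
        using fo[of "cnj c *s u" v] V that
        by (simp add: inner_smult vec.subspace_scale flip: vector_ssub_ldistrib)
    qed
  qed (auto intro: vec.vector_space_axioms)
  then have p: "matrix f *v v = f v" for v
    by (rule matrix_works)
  have fid: "f v = v" if "v \<in> V" for v
    using that by (intro uniq) auto
  have "selfadjoint (matrix f)"
  proof (rule selfadjointI)
    fix v w
    have "f v \<bullet> w = f v \<bullet> f w" "v \<bullet> f w = f v \<bullet> f w"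
      using fo[OF fV[of v], of w] fo[OF fV[of w], of v] by (simp_all add: algebra_simps inner_commute)
    then show "(matrix f *v v) \<bullet> w = v \<bullet> (matrix f *v w)"
      by (simp add: p)
  qed
  moreover have "matrix f ** matrix f = matrix f"
    by (rule cmat_eqI) (simp add: p fid fV flip: matrix_vector_mul_assoc)
  moreover have "range ((*v) (matrix f)) = V"
    using fV fid by (auto simp: p image_iff) metis
  ultimately show ?thesis
    using that by (auto simp: is_projection_def)
qed

lemma projection_range_inject:
  assumes "is_projection p" "is_projection q" "range ((*v) p) = range ((*v) q)"
  shows "p = q"
  using assms by (intro projection_le_antisym) (auto simp: projection_le_iff_range)

lemma csubspace_range: "vec.subspace (range ((*v) (x::'n::finite cmat)))"
  using vec.subspace_image vec.subspace_UNIV matrix_vector_mul_linear_gen by blast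

section \<open>Eigenprojections and spectral projections\<close>

lemma csubspace_eigenspace: "vec.subspace (eigenspace a t)"
  by (auto simp: vec.subspace_def eigenspace_def matrix_vector_right_distrib
      vector_scalar_commute vector_smult_assoc mult.commute vec.scale_right_distrib)

text \<open>A projection is determined by its range, so the definite description in
  \<open>eigenprojection\<close> denotes.\<close>

lemma eigenprojection:
  shows is_projection_eigenprojection: "is_projection (eigenprojection a t)"
    and range_eigenprojection: "range ((*v) (eigenprojection a t)) = eigenspace a t"
proof -
  have "\<exists>!p. is_projection p \<and> range ((*v) p) = eigenspace a t"
    using projection_onto_exists[OF csubspace_eigenspace] projection_range_inject by metis
  from theI'[OF this]
  show "is_projection (eigenprojection a t)" "range ((*v) (eigenprojection a t)) = eigenspace a t"
    by (simp_all add: eigenprojection_def)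
qed

text \<open>For eigenvectors \<open>y\<close> of \<open>s\<close> and \<open>x\<close> of
  \<open>t\<close>, moving \<open>a\<close> across the inner product gives
  \<open>s (y \<bullet> x) = t (y \<bullet> x)\<close>. This controls only the real part of the
  Hermitian product, but \<open>cmat_eq_0I\<close> tests against all vectors, so the matrix product
  vanishes.\<close>

lemma eigenprojection_orthogonal:
  assumes a: "selfadjoint a" and "s \<noteq> t"
  shows "eigenprojection a s ** eigenprojection a t = 0"
proof (rule cmat_eq_0I)
  fix v w
  let ?x = "eigenprojection a t *v v" and ?y = "eigenprojection a s *v w"
  have "?x \<in> eigenspace a t" "?y \<in> eigenspace a s"
    by (metis range_eigenprojection rangeI)+
  then have "a *v ?x = t *\<^sub>R ?x" "a *v ?y = s *\<^sub>R ?y"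
    by (simp_all add: eigenspace_def scaleR_eq_smult)
  moreover have "(a *v ?y) \<bullet> ?x = ?y \<bullet> (a *v ?x)"
    by (rule inner_selfadjoint[OF a])
  ultimately have "?y \<bullet> ?x = 0"
    using \<open>s \<noteq> t\<close> by simp
  then show "w \<bullet> ((eigenprojection a s ** eigenprojection a t) *v v) = 0"
    using is_projection_eigenprojection[of a s]
    by (simp add: is_projection_def inner_selfadjoint flip: matrix_vector_mul_assoc)
qed

text \<open>The indicator takes the values 0 and 1, so every summand is 0 or an eigenprojection, and
  distinct summands are orthogonal.\<close>

lemma is_projection_spectral_projection:
  assumes "selfadjoint a"
  shows "is_projection (\<chi>\<^sub>s\<^sub>p \<Delta> a)"
proof -
  have "is_projection ((indicator \<Delta> t :: real) *\<^sub>R eigenprojection a t)" for t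
    using is_projection_eigenprojection by (cases "t \<in> \<Delta>") auto
  moreover have "(indicator \<Delta> s *\<^sub>R eigenprojection a s) ** (indicator \<Delta> t *\<^sub>R eigenprojection a t) = 0"
    if "s \<noteq> t" for s t
    using eigenprojection_orthogonal[OF assms that]
    by (cases "s \<in> \<Delta>"; cases "t \<in> \<Delta>") auto
  ultimately show ?thesis
    unfolding spectral_projection_def functional_calculus_def by (intro is_projection_sum)
qed


section \<open>Contexts\<close>

lemma context_closed:
  assumes "C \<in> contexts"
  shows context_one: "mat 1 \<in> C"
    and context_add: "x \<in> C \<Longrightarrow> y \<in> C \<Longrightarrow> x + y \<in> C"
    and context_mult: "x \<in> C \<Longrightarrow> y \<in> C \<Longrightarrow> x ** y \<in> C"
    and context_cscale: "x \<in> C \<Longrightarrow> cscale c x \<in> C"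
    and context_adj: "x \<in> C \<Longrightarrow> adj x \<in> C"
    and context_commute: "x \<in> C \<Longrightarrow> y \<in> C \<Longrightarrow> x ** y = y ** x"
    and context_bicommutant: "commutant (commutant C) = C"
  using assms
  by (auto simp: contexts_def von_neumann_subalgebra_def unital_star_subalgebra_def)

lemma context_diff: "C \<in> contexts \<Longrightarrow> x \<in> C \<Longrightarrow> y \<in> C \<Longrightarrow> x - y \<in> C"
  using context_add[of C x "cscale (- 1) y"] context_cscale[of C y "- 1"] by (simp add: cscale_minus_one)

lemma context_zero: "C \<in> contexts \<Longrightarrow> 0 \<in> C"
  using context_diff[OF _ context_one context_one] by fastforce

lemma context_sum: "C \<in> contexts \<Longrightarrow> (\<And>i. i \<in> I \<Longrightarrow> f i \<in> C) \<Longrightarrow> (\<Sum>i\<in>I. f i) \<in> C"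
  by (induction I rule: infinite_finite_induct) (simp_all add: context_zero context_add)

lemma commutant_adj:
  assumes C: "C \<in> contexts" and y: "y \<in> commutant C"
  shows "adj y \<in> commutant C"
  unfolding commutant_def
proof (intro CollectI ballI)
  fix x assume "x \<in> C"
  then have "y ** adj x = adj x ** y"
    using y context_adj[OF C] by (simp add: commutant_def)
  then show "adj y ** x = x ** adj y"
    by (metis adj_adj adj_mult)
qed

lemma commutant_range_invariant:
  assumes "y \<in> commutant C" "x \<in> C" "v \<in> range ((*v) x)"
  shows "y *v v \<in> range ((*v) x)"
  using assms
  by (auto simp: commutant_def matrix_vector_mul_assoc) (metis matrix_vector_mul_assoc rangeI)

text \<open>By the double commutant condition, commuting with the commutant is membership; this is
  where the definition of a von Neumann algebra is used.\<close>

lemma projection_mem_context: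
  assumes C: "C \<in> contexts" and p: "is_projection p"
    and inv: "\<And>y v. y \<in> commutant C \<Longrightarrow> v \<in> range ((*v) p) \<Longrightarrow> y *v v \<in> range ((*v) p)"
  shows "p \<in> Proj C"
proof -
  have eq: "p ** (y ** p) = y ** p" if "y \<in> commutant C" for y
    unfolding projection_absorb_iff[OF p]
    using inv[OF that] by (auto simp flip: matrix_vector_mul_assoc)
  have "p ** y = y ** p" if y: "y \<in> commutant C" for y
  proof -
    \<comment> \<open>Invariance under \<open>y\<close> gives \<open>p y p = y p\<close>. Invariance
      under \<open>adj y\<close>, after taking adjoints, gives \<open>p y p = p y\<close>; together
      they give commutation.\<close>
    have "adj (p ** (adj y ** p)) = adj (adj y ** p)"
      using eq[OF commutant_adj[OF C y]] by simp
    then have "(p ** y) ** p = p ** y"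
      using p by (simp add: adj_mult is_projection_def selfadjoint_def)
    with eq[OF y] show ?thesis
      by (simp add: matrix_mul_assoc)
  qed
  then have "p \<in> commutant (commutant C)"
    by (simp add: commutant_def)
  then show ?thesis
    using p context_bicommutant[OF C] by (simp add: Proj_def)
qed

section \<open>Products and suprema of projections in a context, and inner daseinisation\<close>

lemma Proj_is_projection: "p \<in> Proj C \<Longrightarrow> is_projection p"
  and Proj_mem: "p \<in> Proj C \<Longrightarrow> p \<in> C"
  by (simp_all add: Proj_def)

lemma Proj_mult:
  assumes "C \<in> contexts" "p \<in> Proj C" "q \<in> Proj C"
  shows "p ** q \<in> Proj C"
  using assms by (simp add: Proj_def context_mult context_commute is_projection_mult)

lemma Proj_mult_le:
  assumes C: "C \<in> contexts" and p: "p \<in> Proj C" and q: "q \<in> Proj C"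
  shows "p ** q \<preceq> p" "p ** q \<preceq> q"
proof -
  have pq: "is_projection (p ** q)"
    using Proj_mult[OF C p q] by (rule Proj_is_projection)
  have "p ** (p ** q) = p ** q"
    using p by (simp add: Proj_def is_projection_def matrix_mul_assoc)
  then show "p ** q \<preceq> p"
    using pq p by (simp add: projection_le_iff Proj_is_projection)
  have "q ** (p ** q) = p ** (q ** q)"
    using context_commute[OF C Proj_mem[OF p] Proj_mem[OF q]] by (metis matrix_mul_assoc)
  then have "q ** (p ** q) = p ** q"
    using q by (simp add: Proj_def is_projection_def)
  then show "p ** q \<preceq> q"
    using pq q by (simp add: projection_le_iff Proj_is_projection)
qed

text \<open>The supremum is the projection onto the span of all ranges. Each range is invariant
  under the commutant, hence so is the span, and the projection lies in \<open>C\<close>. Minimality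
  is stated against all projections \<open>s\<close>, including those outside \<open>C\<close>, for
  use with daseinisation.\<close>

lemma Proj_Sup_exists:
  assumes C: "C \<in> contexts" and Q: "Q \<subseteq> Proj C"
  obtains r where "r \<in> Proj C" "\<And>q. q \<in> Q \<Longrightarrow> q \<preceq> r"
    and "\<And>s. is_projection s \<Longrightarrow> (\<And>q. q \<in> Q \<Longrightarrow> q \<preceq> s) \<Longrightarrow> r \<preceq> s"
proof -
  let ?S = "\<Union>q\<in>Q. range ((*v) q)"
  obtain r where r: "is_projection r" "range ((*v) r) = vec.span ?S"
    using projection_onto_exists[OF vec.subspace_span] by blast
  have le_iff: "r \<preceq> s \<longleftrightarrow> (\<forall>q\<in>Q. q \<preceq> s)" if s: "is_projection s" for s
  proof -
    have le_iff: "q \<preceq> s \<longleftrightarrow> range ((*v) q) \<subseteq> range ((*v) s)" if "q \<in> Q" for q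
      using that Q projection_le_iff_range[OF s] Proj_is_projection by blast
    have "r \<preceq> s \<longleftrightarrow> ?S \<subseteq> range ((*v) s)"
      unfolding projection_le_iff_range[OF s r(1)] r(2)
      by (meson csubspace_range order_trans vec.span_minimal vec.span_superset)
    also have "\<dots> \<longleftrightarrow> (\<forall>q\<in>Q. q \<preceq> s)"
      using le_iff by (simp add: UN_subset_iff)
    finally show ?thesis .
  qed
  have "r \<in> Proj C"
  proof (rule projection_mem_context[OF C r(1)])
    fix y v assume y: "y \<in> commutant C" and v: "v \<in> range ((*v) r)"
    have "vec.subspace {v. y *v v \<in> vec.span ?S}"
      by (auto simp: vec.subspace_def matrix_vector_right_distrib vector_scalar_commute
          vec.span_zero vec.span_add vec.span_scale)
    moreover have "?S \<subseteq> {v. y *v v \<in> vec.span ?S}"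
      using commutant_range_invariant[OF y] Q
      by (fastforce simp: Proj_def intro: vec.span_base)
    ultimately have "vec.span ?S \<subseteq> {v. y *v v \<in> vec.span ?S}"
      by (rule vec.span_minimal[rotated])
    then show "y *v v \<in> range ((*v) r)"
      using v unfolding r(2) by blast
  qed
  moreover have "q \<preceq> r" if "q \<in> Q" for q
    using le_iff[OF r(1)] that r(1) by (simp add: projection_le_iff_range)
  ultimately show ?thesis
    using that le_iff by blast
qed

text \<open>The projection \<open>p\<close> may lie outside \<open>C\<close>, yet it bounds every
  candidate; minimality of the supremum among all projections therefore gives
  \<open>\<delta>\<^sup>i p C \<preceq> p\<close>.\<close>

lemma inner_daseinisation_props:
  assumes C: "C \<in> contexts" and p: "is_projection p"
  shows inner_daseinisation_Proj: "\<delta>\<^sup>i p C \<in> Proj C"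
    and inner_daseinisation_le: "\<delta>\<^sup>i p C \<preceq> p"
    and le_inner_daseinisation: "q \<in> Proj C \<Longrightarrow> q \<preceq> p \<Longrightarrow> q \<preceq> \<delta>\<^sup>i p C"
proof -
  let ?Q = "{q \<in> Proj C. q \<preceq> p}"
  obtain r where r: "r \<in> Proj C" "\<And>q. q \<in> ?Q \<Longrightarrow> q \<preceq> r"
    "\<And>s. is_projection s \<Longrightarrow> (\<And>q. q \<in> ?Q \<Longrightarrow> q \<preceq> s) \<Longrightarrow> r \<preceq> s"
    by (rule Proj_Sup_exists[OF C, of ?Q]) auto
  have "\<delta>\<^sup>i p C = r"
    unfolding inner_daseinisation_def Proj_Sup_def
  proof (rule the_equality)
    show "r \<in> Proj C \<and> (\<forall>q\<in>?Q. q \<preceq> r) \<and> (\<forall>s\<in>Proj C. (\<forall>q\<in>?Q. q \<preceq> s) \<longrightarrow> r \<preceq> s)"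
      using r Proj_is_projection by blast
    fix r' assume r': "r' \<in> Proj C \<and> (\<forall>q\<in>?Q. q \<preceq> r') \<and>
      (\<forall>s\<in>Proj C. (\<forall>q\<in>?Q. q \<preceq> s) \<longrightarrow> r' \<preceq> s)"
    show "r' = r"
    proof (rule projection_le_antisym)
      show "r' \<preceq> r" using r' r by blast
      show "r \<preceq> r'" using r' r(3) Proj_is_projection by blast
    qed (use r r' Proj_is_projection in blast)+
  qed
  then show "\<delta>\<^sup>i p C \<in> Proj C" "\<delta>\<^sup>i p C \<preceq> p" "q \<in> Proj C \<Longrightarrow> q \<preceq> p \<Longrightarrow> q \<preceq> \<delta>\<^sup>i p C"
    using r p by blast+
qed


section \<open>Minimal projections\<close>

text \<open>These are the atoms of the projection lattice of \<open>C\<close>; they serve as labels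
  for the points of the Gelfand spectrum.\<close>

definition minimal_projections :: "'n::finite cmat set \<Rightarrow> 'n cmat set" where
  "minimal_projections C =
     {p \<in> Proj C. p \<noteq> 0 \<and> (\<forall>q\<in>Proj C. q \<preceq> p \<longrightarrow> q = 0 \<or> q = p)}"

lemma minimal_projectionsD:
  assumes "p \<in> minimal_projections C"
  shows "p \<in> Proj C" "p \<in> C" "is_projection p" "p \<noteq> 0"
    and "\<And>q. q \<in> Proj C \<Longrightarrow> q \<preceq> p \<Longrightarrow> q = 0 \<or> q = p"
  using assms by (auto simp: minimal_projections_def Proj_def)

text \<open>Descent on the real dimension of the range: a projection that is not an atom has a
  nonzero proper subprojection in \<open>C\<close>, whose range is strictly smaller.\<close>

lemma minimal_projection_exists:
  assumes C: "C \<in> contexts" and "r \<in> Proj C" "r \<noteq> 0"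
  shows "\<exists>p\<in>minimal_projections C. p \<preceq> r"
  using assms(2,3)
proof (induction "dim (range ((*v) r))" arbitrary: r rule: less_induct)
  case less
  note pr = Proj_is_projection
  show ?case
  proof (cases "r \<in> minimal_projections C")
    case True
    then show ?thesis
      using less.prems by (intro bexI[of _ r]) (auto simp: projection_le_iff_range pr)
  next
    case False
    then obtain q where q: "q \<in> Proj C" "q \<preceq> r" "q \<noteq> 0" "q \<noteq> r"
      using less.prems by (auto simp: minimal_projections_def)
    have sub: "range ((*v) q) \<subseteq> range ((*v) r)"
      using q less.prems by (simp add: projection_le_iff_range pr)
    have "range ((*v) q) \<noteq> range ((*v) r)"
      using q less.prems projection_range_inject pr by blast
    then have "dim (range ((*v) q)) < dim (range ((*v) r))"
      using sub subspace_dim_equal csubspace_imp_subspace csubspace_range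
      by (metis not_le)
    from less.hyps[OF this q(1,3)] obtain p where p: "p \<in> minimal_projections C" "p \<preceq> q"
      by blast
    then have "p \<preceq> r"
      using sub q less.prems minimal_projectionsD(3)[OF p(1)]
      by (simp add: projection_le_iff_range pr)
    with p show ?thesis by blast
  qed
qed

text \<open>A maximum of the Rayleigh quotient over the unit sphere of an invariant subspace is attained
  at an eigenvector.\<close>

lemma selfadjoint_eigenvector_exists:
  fixes V :: "(complex^'n::finite) set"
  assumes x: "selfadjoint x" and V: "subspace V" and ne: "V \<noteq> {0}"
    and inv: "\<And>v. v \<in> V \<Longrightarrow> x *v v \<in> V"
  obtains t v where "v \<in> V" "v \<noteq> 0" "x *v v = t *\<^sub>R v"
proof -
  have lin: "linear ((*v) x)"
    by (rule matrix_vector_mul_linear)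
  have "compact (V \<inter> sphere 0 1)"
    using V by (intro closed_Int_compact closed_subspace) auto
  moreover obtain u where u: "u \<in> V" "u \<noteq> 0"
    using ne subspace_0[OF V] by blast
  then have "u /\<^sub>R norm u \<in> V \<inter> sphere 0 1"
    using V by (simp add: subspace_scale)
  then have "V \<inter> sphere 0 1 \<noteq> {}"
    by blast
  moreover have "continuous_on (V \<inter> sphere 0 1) (\<lambda>v. v \<bullet> (x *v v))"
    using lin by (intro continuous_intros linear_continuous_on) (simp add: linear_conv_bounded_linear)
  ultimately obtain v where v: "v \<in> V" "norm v = 1"
    and max: "\<And>w. w \<in> V \<Longrightarrow> norm w = 1 \<Longrightarrow> w \<bullet> (x *v w) \<le> v \<bullet> (x *v v)"
    using continuous_attains_sup[of "V \<inter> sphere 0 1" "\<lambda>v. v \<bullet> (x *v v)"] by fastforce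
  define t where "t = v \<bullet> (x *v v)"
  \<comment> \<open>This is the quadratic form of \<open>t - x\<close>: nonnegative on
    \<open>V\<close> by maximality of \<open>t\<close>, and zero at \<open>v\<close>.\<close>
  define b where "b w = t * (w \<bullet> w) - w \<bullet> (x *v w)" for w
  have b_nonneg: "0 \<le> b w" if w: "w \<in> V" for w
  proof (cases "w = 0")
    case False
    then have "(w /\<^sub>R norm w) \<bullet> (x *v (w /\<^sub>R norm w)) \<le> t"
      unfolding t_def using w V by (intro max) (simp_all add: subspace_scale)
    then have "(w \<bullet> (x *v w)) / (norm w)\<^sup>2 \<le> t"
      by (simp add: linear_scale[OF lin] power2_eq_square divide_inverse mult_ac)
    then show ?thesis
      using False by (simp add: b_def divide_le_eq power2_norm_eq_inner)
  qed (simp add: b_def)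
  \<comment> \<open>Up to a factor 2, \<open>z\<close> is the gradient of \<open>b\<close> at
    \<open>v\<close>; it must vanish because \<open>b\<close> has a minimum over \<open>V\<close>
    there.\<close>
  define z where "z = t *\<^sub>R v - x *v v"
  define N where "N = z \<bullet> z"
  have z: "z \<in> V"
    using V v inv by (simp add: z_def subspace_diff subspace_scale)
  have b_line: "b (v + s *\<^sub>R z) = 2 * s * N + s\<^sup>2 * b z" for s
  proof -
    have "v \<bullet> v = 1"
      using v(2) by (simp add: norm_eq_1)
    moreover have "z \<bullet> z = z \<bullet> (t *\<^sub>R v - x *v v)"
      by (simp only: z_def)
    then have N: "N = t * (v \<bullet> z) - z \<bullet> (x *v v)"
      by (simp add: N_def inner_diff_right inner_commute)
    moreover have "v \<bullet> (x *v z) = z \<bullet> (x *v v)"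
      using inner_selfadjoint[OF x, of v z] by (simp add: inner_commute)
    ultimately show ?thesis
      by (simp add: b_def N linear_add[OF lin] linear_scale[OF lin] inner_add_left inner_add_right
          t_def inner_commute power2_eq_square algebra_simps)
  qed
  have "N = 0"
  proof (rule ccontr)
    assume "N \<noteq> 0"
    define B where "B = b z"
    have B: "B \<ge> 0"
      using b_nonneg[OF z] by (simp add: B_def)
    \<comment> \<open>A negative step along \<open>z\<close>, short enough for the linear term
      \<open>2 s N\<close> to outweigh \<open>s^2 B\<close>; the added 1 keeps the denominator
      positive when \<open>B = 0\<close>.\<close>
    define s where "s = - N / (B + 1)"
    have "0 \<le> b (v + s *\<^sub>R z)"
      using V v z by (intro b_nonneg) (simp add: subspace_add subspace_scale)
    also have "\<dots> = - (N\<^sup>2 * (B + 2)) / (B + 1)\<^sup>2"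
      unfolding b_line B_def[symmetric] s_def using B
      by (simp add: divide_simps) (simp add: power2_eq_square algebra_simps)
    also have "\<dots> < 0"
      using B \<open>N \<noteq> 0\<close> by (simp add: divide_neg_pos)
    finally show False by simp
  qed
  then have "x *v v = t *\<^sub>R v"
    by (simp add: N_def z_def)
  moreover have "v \<noteq> 0"
    using v(2) by auto
  ultimately show ?thesis
    using that v(1) by blast
qed

text \<open>The range of \<open>p\<close> is invariant under \<open>x\<close>, so it contains an
  eigenvector. Its intersection with that eigenspace is invariant under the commutant, so the
  projection \<open>q\<close> onto it belongs to \<open>C\<close>. It is nonzero and below
  \<open>p\<close>; minimality gives \<open>q = p\<close>, and \<open>x\<close> is scalar on the
  whole range.\<close>

lemma minimal_projection_scalar_selfadjoint:
  assumes C: "C \<in> contexts" and p: "p \<in> minimal_projections C" and x: "x \<in> C" "selfadjoint x"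
  shows "\<exists>t. x ** p = cscale t p"
proof -
  note p' = minimal_projectionsD[OF p]
  have comm: "x ** p = p ** x"
    using C x(1) p'(2) by (rule context_commute)
  have "x *v v \<in> range ((*v) p)" if "v \<in> range ((*v) p)" for v
    using that comm by (auto simp: matrix_vector_mul_assoc) (metis matrix_vector_mul_assoc rangeI)
  moreover have "range ((*v) p) \<noteq> {0}"
    using p'(4) by (metis cmat_eqI matrix_vector_mult_0 rangeI singletonD)
  ultimately obtain t v where v: "v \<in> range ((*v) p)" "v \<noteq> 0" "x *v v = t *\<^sub>R v"
    using selfadjoint_eigenvector_exists[OF x(2) csubspace_imp_subspace[OF csubspace_range]] by metis
  let ?K = "eigenspace x t \<inter> range ((*v) p)"
  obtain q where q: "is_projection q" "range ((*v) q) = ?K"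
    using projection_onto_exists[OF vec.subspace_inter[OF csubspace_eigenspace csubspace_range]] by blast
  have "q \<in> Proj C"
  proof (rule projection_mem_context[OF C q(1)])
    fix y w assume y: "y \<in> commutant C" and w: "w \<in> range ((*v) q)"
    have "x *v (y *v w) = y *v (x *v w)"
      using y x(1) by (simp add: commutant_def matrix_vector_mul_assoc)
    then have "y *v w \<in> eigenspace x t"
      using w q(2) by (simp add: eigenspace_def vector_scalar_commute)
    then show "y *v w \<in> range ((*v) q)"
      using commutant_range_invariant[OF y p'(2)] w q(2) by blast
  qed
  moreover have "q \<preceq> p"
    using q p'(3) by (simp add: projection_le_iff_range)
  moreover have "q \<noteq> 0"
  proof
    assume "q = 0"
    then have "?K = {0}"
      using q(2) by auto
    then show False
      using v by (auto simp: eigenspace_def scaleR_eq_smult)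
  qed
  ultimately have "q = p"
    using p'(5) by blast
  then have "x *v (p *v w) = complex_of_real t *s (p *v w)" for w
    using q(2) by (auto simp: eigenspace_def)
  then have "x ** p = cscale t p"
    by (intro cmat_eqI) (simp add: cscale_mult_vector flip: matrix_vector_mul_assoc)
  then show ?thesis ..
qed

text \<open>Reduction to the self-adjoint case by splitting \<open>x\<close> as
  \<open>h + \<i> k\<close> with \<open>h\<close> and \<open>k\<close> self-adjoint elements of
  \<open>C\<close>.\<close>

lemma minimal_projection_scalar:
  assumes C: "C \<in> contexts" and p: "p \<in> minimal_projections C" and x: "x \<in> C"
  shows "\<exists>t. x ** p = cscale t p"
proof -
  let ?h = "cscale (1/2) (x + adj x)" and ?k = "cscale (- \<i>/2) (x - adj x)"
  have "?h \<in> C" "?k \<in> C"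
    using C x by (simp_all add: context_cscale context_add context_diff context_adj)
  moreover have "selfadjoint ?h" "selfadjoint ?k"
    by (simp_all add: selfadjoint_def vec_eq_iff adj_nth cscale_nth algebra_simps)
  ultimately obtain s t where st: "?h ** p = cscale s p" "?k ** p = cscale t p"
    using minimal_projection_scalar_selfadjoint[OF C p] by metis
  have "x = ?h + cscale \<i> ?k"
    by (simp add: vec_eq_iff adj_nth cscale_nth algebra_simps)
  then have "x ** p = ?h ** p + cscale \<i> (?k ** p)"
    by (metis cscale_mult_left matrix_mult_add_left)
  also have "\<dots> = cscale (s + \<i> * t) p"
    unfolding st by (simp add: cscale_add_left cscale_cscale)
  finally show ?thesis ..
qed

text \<open>The product is a projection of \<open>C\<close> below both atoms; were it nonzero, it
  would equal each of them.\<close>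

lemma minimal_projections_orthogonal:
  assumes C: "C \<in> contexts" and p: "p \<in> minimal_projections C" and q: "q \<in> minimal_projections C"
    and "p \<noteq> q"
  shows "p ** q = 0"
  using Proj_mult[OF C] Proj_mult_le[OF C] minimal_projectionsD[OF p] minimal_projectionsD[OF q] \<open>p \<noteq> q\<close>
  by metis

text \<open>One nonzero vector from the range of each atom gives an orthogonal, hence linearly
  independent, family in a finite-dimensional space.\<close>

lemma finite_minimal_projections:
  assumes C: "C \<in> contexts"
  shows "finite (minimal_projections C)"
proof -
  let ?M = "minimal_projections C"
  have "\<exists>v. p *v v = v \<and> v \<noteq> 0" if "p \<in> ?M" for p
  proof -
    obtain w where "p *v w \<noteq> 0"
      using minimal_projectionsD(4)[OF \<open>p \<in> ?M\<close>] by (metis cmat_eqI matrix_vector_mult_0)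
    then show ?thesis
      using projection_fix[OF minimal_projectionsD(3)[OF \<open>p \<in> ?M\<close>]] by blast
  qed
  then obtain f where f: "\<And>p. p \<in> ?M \<Longrightarrow> p *v f p = f p" "\<And>p. p \<in> ?M \<Longrightarrow> f p \<noteq> 0"
    by metis
  have orth: "f p \<bullet> f q = 0" if "p \<in> ?M" "q \<in> ?M" "p \<noteq> q" for p q
  proof -
    have "f p \<bullet> f q = (p *v f p) \<bullet> (q *v f q)"
      using f that by simp
    also have "\<dots> = f p \<bullet> ((p ** q) *v f q)"
      using minimal_projectionsD(3)[OF that(1)]
      by (simp add: inner_selfadjoint is_projection_def matrix_vector_mul_assoc)
    finally show ?thesis
      by (simp add: minimal_projections_orthogonal[OF C that])
  qed
  have "inj_on f ?M"
    by (rule inj_onI) (metis f(2) inner_eq_zero_iff orth)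
  moreover have "independent (f ` ?M)"
    using orth f(2) by (intro pairwise_orthogonal_independent) (auto simp: pairwise_def orthogonal_def)
  then have "finite (f ` ?M)"
    by (rule independent_imp_finite)
  ultimately show ?thesis
    by (rule finite_imageD[rotated])
qed

text \<open>Otherwise the complement of the sum is a nonzero projection of \<open>C\<close> and
  dominates an atom \<open>p\<close>. Being below the complement, \<open>p\<close> annihilates the
  sum; being one of its orthogonal summands, \<open>p\<close> times the sum is
  \<open>p\<close>.\<close>

lemma sum_minimal_projections:
  assumes C: "C \<in> contexts"
  shows "(\<Sum>p\<in>minimal_projections C. p) = mat 1"
proof (rule ccontr)
  let ?M = "minimal_projections C"
  let ?s = "\<Sum>p\<in>?M. p"
  assume "?s \<noteq> mat 1"
  moreover have s: "is_projection ?s"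
    using minimal_projectionsD(3) minimal_projections_orthogonal[OF C] by (intro is_projection_sum) auto
  then have r: "is_projection (mat 1 - ?s)"
    by (intro is_projection_diff) auto
  have "?s \<in> C"
    using C minimal_projectionsD(2) by (intro context_sum) auto
  then have "mat 1 - ?s \<in> Proj C"
    using C r by (simp add: Proj_def context_diff context_one)
  ultimately obtain p where p: "p \<in> ?M" "p \<preceq> mat 1 - ?s"
    using minimal_projection_exists[OF C, of "mat 1 - ?s"] by auto
  have "(mat 1 - ?s) ** p = p"
    using p(2) by (simp add: projection_le_iff r minimal_projectionsD(3)[OF p(1)])
  then have "p ** (mat 1 - ?s) = p"
    using projection_absorb_commute[of "mat 1 - ?s" p] r minimal_projectionsD(3)[OF p(1)]
    by (simp add: is_projection_def)
  then have "p ** ?s = 0"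
    by (simp add: matrix_mult_diff_right)
  moreover have "p ** ?s = (\<Sum>q\<in>?M. if q = p then p else 0)"
    unfolding matrix_mult_sum_right
    using minimal_projections_orthogonal[OF C p(1)] minimal_projectionsD(3)[OF p(1)]
    by (intro sum.cong) (auto simp: is_projection_def)
  then have "p ** ?s = p"
    using finite_minimal_projections[OF C] p(1) by simp
  ultimately show False
    using minimal_projectionsD(4)[OF p(1)] by simp
qed


section \<open>Characters\<close>

lemma gelfand_spectrumD:
  assumes "l \<in> \<Sigma>\<^sub>G C"
  shows "l \<in> extensional C"
    and "x \<in> C \<Longrightarrow> y \<in> C \<Longrightarrow> l (x + y) = l x + l y"
    and "x \<in> C \<Longrightarrow> l (cscale c x) = c * l x"
    and "x \<in> C \<Longrightarrow> y \<in> C \<Longrightarrow> l (x ** y) = l x * l y"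
  using assms by (simp_all add: gelfand_spectrum_def clinear_on_def)

lemma character_one:
  assumes C: "C \<in> contexts" and l: "l \<in> \<Sigma>\<^sub>G C"
  shows "l (mat 1) = 1"
proof -
  obtain x where x: "x \<in> C" "l x \<noteq> 0"
    using l by (auto simp: gelfand_spectrum_def)
  have "l (x ** mat 1) = l x * l (mat 1)"
    using gelfand_spectrumD(4)[OF l x(1) context_one[OF C]] .
  with x(2) show ?thesis by simp
qed

lemma character_zero:
  assumes C: "C \<in> contexts" and l: "l \<in> \<Sigma>\<^sub>G C"
  shows "l 0 = 0"
  using gelfand_spectrumD(3)[OF l context_zero[OF C], of 0] by simp

lemma character_sum:
  assumes C: "C \<in> contexts" and l: "l \<in> \<Sigma>\<^sub>G C"
  shows "(\<And>i. i \<in> I \<Longrightarrow> f i \<in> C) \<Longrightarrow> l (\<Sum>i\<in>I. f i) = (\<Sum>i\<in>I. l (f i))"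
  by (induction I rule: infinite_finite_induct)
    (simp_all add: character_zero[OF C l] gelfand_spectrumD(2)[OF l] context_sum[OF C])

lemma character_projection:
  assumes l: "l \<in> \<Sigma>\<^sub>G C" and p: "p \<in> Proj C"
  shows "l p = 0 \<or> l p = 1"
proof -
  have "l p * l p = l p"
    using gelfand_spectrumD(4)[OF l, of p p] p by (simp add: Proj_def is_projection_def)
  then show ?thesis by simp
qed

lemma character_projection_mono:
  assumes l: "l \<in> \<Sigma>\<^sub>G C" and pq: "p \<in> Proj C" "q \<in> Proj C" "q \<preceq> p" and "l q = 1"
  shows "l p = 1"
  using gelfand_spectrumD(4)[OF l, of p q] pq \<open>l q = 1\<close>
  by (simp add: Proj_def projection_le_iff)

text \<open>The eigenvalue of \<open>x\<close> on the range of the atom \<open>p\<close>.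
  Restricting to \<open>C\<close> follows the \<open>extensional\<close> convention of the spectrum,
  so that equal characters are equal functions.\<close>

definition point_character :: "'n::finite cmat set \<Rightarrow> 'n cmat \<Rightarrow> 'n cmat \<Rightarrow> complex" where
  "point_character C p = restrict (\<lambda>x. THE t. x ** p = cscale t p) C"

lemma cscale_right_cancel: "p \<noteq> 0 \<Longrightarrow> cscale s p = cscale t p \<longleftrightarrow> s = t"
  by (auto simp: vec_eq_iff cscale_nth)

lemma point_character_eqI:
  assumes "p \<in> minimal_projections C" "x \<in> C" "x ** p = cscale t p"
  shows "point_character C p x = t"
  using assms minimal_projectionsD(4)[OF assms(1)]
  by (auto simp: point_character_def cscale_right_cancel)

lemma mult_minimal_projection:
  assumes "C \<in> contexts" "p \<in> minimal_projections C" "x \<in> C"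
  shows "x ** p = cscale (point_character C p x) p"
  using minimal_projection_scalar[OF assms] point_character_eqI[OF assms(2,3)] by blast

lemma point_character_in_spectrum:
  assumes C: "C \<in> contexts" and p: "p \<in> minimal_projections C"
  shows "point_character C p \<in> \<Sigma>\<^sub>G C"
proof -
  let ?l = "point_character C p"
  note m = mult_minimal_projection[OF C p] and eqI = point_character_eqI[OF p]
  have "?l (x + y) = ?l x + ?l y" if "x \<in> C" "y \<in> C" for x y
    using that by (intro eqI) (simp_all add: context_add[OF C] matrix_mult_add_left m cscale_add_left)
  moreover have "?l (cscale c x) = c * ?l x" if "x \<in> C" for x c
    using that by (intro eqI) (simp_all add: context_cscale[OF C] cscale_mult_left m cscale_cscale)
  moreover have "?l (x ** y) = ?l x * ?l y" if "x \<in> C" "y \<in> C" for x y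
  proof (rule eqI)
    have "(x ** y) ** p = x ** (y ** p)"
      by (simp add: matrix_mul_assoc)
    then show "(x ** y) ** p = cscale (?l x * ?l y) p"
      using that by (simp add: m cscale_mult_right cscale_cscale mult.commute)
  qed (simp add: that context_mult[OF C])
  moreover have "?l (mat 1) = 1"
    by (rule eqI) (simp_all add: context_one[OF C] cscale_one)
  then have "\<exists>x\<in>C. ?l x \<noteq> 0"
    using context_one[OF C] by force
  ultimately show ?thesis
    by (simp add: gelfand_spectrum_def clinear_on_def point_character_def)
qed

text \<open>Apply \<open>l\<close> to \<open>x ** p\<close>, which is a scalar multiple of
  \<open>p\<close>, and cancel the nonzero factor \<open>l p\<close>.\<close>

lemma character_eq_point_character:
  assumes C: "C \<in> contexts" and l: "l \<in> \<Sigma>\<^sub>G C" and p: "p \<in> minimal_projections C" and "l p \<noteq> 0"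
  shows "l = point_character C p"
proof (rule extensionalityI)
  show "l \<in> extensional C" "point_character C p \<in> extensional C"
    using gelfand_spectrumD(1) l point_character_in_spectrum[OF C p] by blast+
  fix x assume x: "x \<in> C"
  have "l x * l p = l (x ** p)"
    using gelfand_spectrumD(4)[OF l x minimal_projectionsD(2)[OF p]] by simp
  also have "\<dots> = point_character C p x * l p"
    using gelfand_spectrumD(3)[OF l minimal_projectionsD(2)[OF p]]
    by (simp add: mult_minimal_projection[OF C p x])
  finally show "l x = point_character C p x"
    using \<open>l p \<noteq> 0\<close> by simp
qed

lemma point_character_self:
  assumes "p \<in> minimal_projections C"
  shows "point_character C p p = 1"
  using minimal_projectionsD[OF assms]
  by (intro point_character_eqI[OF assms]) (simp_all add: is_projection_def cscale_one)

text \<open>Injective because the character of \<open>q\<close> kills every other atom while each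
  atom has value 1 under its own character. Surjective because the values of \<open>l\<close> on the
  atoms sum to \<open>l (mat 1) = 1\<close>, so one of them is nonzero.\<close>

lemma bij_betw_point_character:
  assumes C: "C \<in> contexts"
  shows "bij_betw (point_character C) (minimal_projections C) (\<Sigma>\<^sub>G C)"
proof (rule bij_betw_imageI)
  let ?M = "minimal_projections C"
  show "inj_on (point_character C) ?M"
  proof (rule inj_onI, rule ccontr)
    fix p q assume pq: "p \<in> ?M" "q \<in> ?M" "point_character C p = point_character C q" "p \<noteq> q"
    have "point_character C q p = 0"
      using minimal_projections_orthogonal[OF C pq(1,2,4)] minimal_projectionsD(2)[OF pq(1)]
      by (intro point_character_eqI[OF pq(2)]) (simp_all add: cscale_eq_0_iff[THEN iffD2])
    then show False
      using point_character_self[OF pq(1)] pq(3) by simp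
  qed
  have "l \<in> point_character C ` ?M" if l: "l \<in> \<Sigma>\<^sub>G C" for l
  proof -
    have "(\<Sum>p\<in>?M. l p) = l (\<Sum>p\<in>?M. p)"
      by (rule character_sum[OF C l, symmetric]) (rule minimal_projectionsD(2))
    then have "(\<Sum>p\<in>?M. l p) = l (mat 1)"
      by (simp only: sum_minimal_projections[OF C])
    also have "\<dots> \<noteq> 0"
      by (simp add: character_one[OF C l])
    finally obtain p where "p \<in> ?M" "l p \<noteq> 0"
      by (meson sum.neutral)
    then show ?thesis
      using character_eq_point_character[OF C l] by blast
  qed
  then show "point_character C ` ?M = \<Sigma>\<^sub>G C"
    using point_character_in_spectrum[OF C] by blast
qed

section \<open>The spectrum of a context is finite and discrete\<close>

lemma minimal_projection_support:
  assumes C: "C \<in> contexts" and p: "p \<in> minimal_projections C"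
  shows "{l \<in> \<Sigma>\<^sub>G C. l p = 1} = {point_character C p}"
proof (intro set_eqI iffI)
  fix l assume "l \<in> {l \<in> \<Sigma>\<^sub>G C. l p = 1}"
  then show "l \<in> {point_character C p}"
    using character_eq_point_character[OF C _ p, of l] by simp
qed (simp add: point_character_in_spectrum[OF C p] point_character_self[OF p])

lemma finite_gelfand_spectrum: "C \<in> contexts \<Longrightarrow> finite (\<Sigma>\<^sub>G C)"
  using bij_betw_finite[OF bij_betw_point_character] finite_minimal_projections by blast

text \<open>A character is 0 or 1 on a projection, so the condition \<open>l p = 1\<close> amounts
  to \<open>l p \<noteq> 0\<close>, which is open for pointwise convergence.\<close>

lemma openin_projection_support:
  assumes p: "p \<in> Proj C"
  shows "openin (gelfand_topology C) {l \<in> \<Sigma>\<^sub>G C. l p = 1}"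
proof -
  have "continuous_map (gelfand_topology C) euclidean (\<lambda>l. l p)"
    unfolding gelfand_topology_def
    by (rule continuous_map_from_subtopology[OF continuous_map_product_projection[OF Proj_mem[OF p]]])
  then have "openin (gelfand_topology C) {l \<in> topspace (gelfand_topology C). l p \<in> - {0}}"
    by (rule openin_continuous_map_preimage) auto
  moreover have "{l \<in> topspace (gelfand_topology C). l p \<in> - {0}} = {l \<in> \<Sigma>\<^sub>G C. l p = 1}"
    using character_projection[OF _ p] by force
  ultimately show ?thesis by simp
qed

text \<open>Every point is the support of its atom and hence open. The topology is therefore
  discrete, and all subsets are Borel.\<close>

lemma sigma_sets_gelfand_topology:
  assumes C: "C \<in> contexts"
  shows "sigma_sets (\<Sigma>\<^sub>G C) {U. openin (gelfand_topology C) U} = Pow (\<Sigma>\<^sub>G C)"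
proof
  show "sigma_sets (\<Sigma>\<^sub>G C) {U. openin (gelfand_topology C) U} \<subseteq> Pow (\<Sigma>\<^sub>G C)"
    using openin_subset[of "gelfand_topology C"]
    by (intro subsetI PowI sigma_sets_into_sp[of "{U. openin (gelfand_topology C) U}"]) auto
  have "openin (gelfand_topology C) {l}" if l: "l \<in> \<Sigma>\<^sub>G C" for l
  proof -
    obtain p where p: "p \<in> minimal_projections C" "l = point_character C p"
      using l bij_betw_imp_surj_on[OF bij_betw_point_character[OF C]] by blast
    then show ?thesis
      using openin_projection_support[OF minimal_projectionsD(1)[OF p(1)]]
      by (simp add: minimal_projection_support[OF C])
  qed
  then have "openin (gelfand_topology C) (\<Union>l\<in>U. {l})" if "U \<subseteq> \<Sigma>\<^sub>G C" for U
    using that by (intro openin_Union) auto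
  then have "openin (gelfand_topology C) U" if "U \<subseteq> \<Sigma>\<^sub>G C" for U
    using that by simp
  then show "Pow (\<Sigma>\<^sub>G C) \<subseteq> sigma_sets (\<Sigma>\<^sub>G C) {U. openin (gelfand_topology C) U}"
    by (blast intro: sigma_sets.Basic)
qed


section \<open>The Riesz-Markov measure\<close>

lemma state_add: "is_state \<psi> \<Longrightarrow> \<psi> (x + y) = \<psi> x + \<psi> y"
  and state_cscale: "is_state \<psi> \<Longrightarrow> \<psi> (cscale c x) = c * \<psi> x"
  and state_one: "is_state \<psi> \<Longrightarrow> \<psi> (mat 1) = 1"
  by (auto simp: is_state_def clinear_on_def)

lemma state_sum:
  assumes "is_state \<psi>"
  shows "\<psi> (\<Sum>i\<in>I. f i) = (\<Sum>i\<in>I. \<psi> (f i))"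
  using state_cscale[OF assms, of 0 0]
  by (induction I rule: infinite_finite_induct) (simp_all add: state_add[OF assms])

lemma state_projection:
  assumes "is_state \<psi>" "is_projection p"
  shows "0 \<le> Re (\<psi> p)" "\<psi> p = complex_of_real (Re (\<psi> p))"
proof -
  have "\<psi> p \<in> \<real>\<^sub>\<ge>\<^sub>0"
    using assms projection_positive by (auto simp: is_state_def)
  then show "0 \<le> Re (\<psi> p)" "\<psi> p = complex_of_real (Re (\<psi> p))"
    by (auto simp: nonneg_Reals_def)
qed

lemma state_projection_mono:
  assumes \<psi>: "is_state \<psi>" and p: "is_projection p" and q: "is_projection q" and "q \<preceq> p"
  shows "Re (\<psi> q) \<le> Re (\<psi> p)"
proof -
  have "is_projection (p - q)"
    using p q \<open>q \<preceq> p\<close> by (simp add: projection_le_iff is_projection_diff)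
  then have "0 \<le> Re (\<psi> (p - q))"
    by (rule state_projection[OF \<psi>])
  moreover have "\<psi> p = \<psi> q + \<psi> (p - q)"
    using state_add[OF \<psi>, of q "p - q"] by simp
  ultimately show ?thesis by simp
qed

text \<open>The condition inside the definite description of \<open>riesz_measure\<close>, named so
  that existence and uniqueness can be proved separately.\<close>

definition represents_state ::
    "('n::finite cmat \<Rightarrow> complex) \<Rightarrow> 'n cmat set \<Rightarrow> ('n cmat \<Rightarrow> complex) measure \<Rightarrow> bool" where
  "represents_state \<psi> C M \<longleftrightarrow> prob_space M \<and> space M = \<Sigma>\<^sub>G C \<and>
     sets M = sigma_sets (\<Sigma>\<^sub>G C) {U. openin (gelfand_topology C) U} \<and>
     (\<forall>c\<in>C. has_bochner_integral M (\<lambda>l. l c) (\<psi> c))"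

text \<open>The Gelfand transform of a projection is the indicator function of its support, so its
  integral is the measure of that set.\<close>

lemma measure_projection_support:
  assumes C: "C \<in> contexts" and M: "represents_state \<psi> C M" and p: "p \<in> Proj C"
  shows "complex_of_real (measure M {l \<in> \<Sigma>\<^sub>G C. l p = 1}) = \<psi> p"
proof -
  let ?A = "{l \<in> \<Sigma>\<^sub>G C. l p = 1}"
  interpret prob_space M
    using M by (simp add: represents_state_def)
  have A: "?A \<in> sets M"
    using M sigma_sets_gelfand_topology[OF C] by (auto simp: represents_state_def)
  have "\<psi> p = (\<integral>l. l p \<partial>M)"
    using M p by (auto simp: represents_state_def Proj_def has_bochner_integral_iff)
  also have "\<dots> = (\<integral>l. complex_of_real (indicator ?A l) \<partial>M)"
    using M character_projection[OF _ p]
    by (intro Bochner_Integration.integral_cong) (auto simp: represents_state_def indicator_def)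
  also have "\<dots> = complex_of_real (measure M ?A)"
    using A by simp
  finally show ?thesis ..
qed

text \<open>On a finite space the point masses determine the measure, and the mass at a point is
  forced to be the state of its atom.\<close>

lemma represents_state_unique:
  assumes C: "C \<in> contexts" and M: "represents_state \<psi> C M" and N: "represents_state \<psi> C N"
  shows "M = N"
proof (rule measure_eqI_finite)
  show "sets M = Pow (\<Sigma>\<^sub>G C)" "sets N = Pow (\<Sigma>\<^sub>G C)"
    using M N sigma_sets_gelfand_topology[OF C] by (simp_all add: represents_state_def)
  show "finite (\<Sigma>\<^sub>G C)"
    by (rule finite_gelfand_spectrum[OF C])
  fix l assume l: "l \<in> \<Sigma>\<^sub>G C"
  obtain p where p: "p \<in> minimal_projections C" "l = point_character C p"
    using l bij_betw_imp_surj_on[OF bij_betw_point_character[OF C]] by blast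
  have val: "emeasure L {l} = ennreal (Re (\<psi> p))" if L: "represents_state \<psi> C L" for L
  proof -
    interpret prob_space L
      using L by (simp add: represents_state_def)
    have "complex_of_real (measure L {l}) = \<psi> p"
      using measure_projection_support[OF C L minimal_projectionsD(1)[OF p(1)]]
      by (simp add: minimal_projection_support[OF C p(1)] p(2))
    from arg_cong[OF this, of Re] show ?thesis
      by (simp add: emeasure_eq_measure)
  qed
  show "emeasure M {l} = emeasure N {l}"
    by (simp add: val[OF M] val[OF N])
qed

text \<open>Weight each point by the state of its atom. Since \<open>c ** p\<close> is the character
  value times \<open>p\<close>, the integral of \<open>c\<close> is the sum of
  \<open>\<psi> (c ** p)\<close> over the atoms, which is \<open>\<psi> c\<close> because the atoms
  sum to the identity.\<close>

lemma represents_state_exists: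
  assumes C: "C \<in> contexts" and \<psi>: "is_state \<psi>"
  shows "\<exists>M. represents_state \<psi> C M"
proof -
  let ?M = "minimal_projections C" and ?S = "\<Sigma>\<^sub>G C" and ?ch = "point_character C"
  define w where "w l = Re (\<psi> (the_inv_into ?M ?ch l))" for l
  note bij = bij_betw_point_character[OF C]
  note fin = finite_gelfand_spectrum[OF C]
  have w: "w (?ch p) = Re (\<psi> p)" if "p \<in> ?M" for p
    using that bij by (simp add: w_def bij_betw_def the_inv_into_f_f)
  have \<psi>p: "complex_of_real (Re (\<psi> p)) = \<psi> p" if "p \<in> ?M" for p
    using state_projection(2)[OF \<psi> minimal_projectionsD(3)[OF that]] by (rule sym)
  have w_nonneg: "0 \<le> w l" if l: "l \<in> ?S" for l
  proof -
    obtain p where "p \<in> ?M" "l = ?ch p"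
      using l bij_betw_imp_surj_on[OF bij] by blast
    then show ?thesis
      using state_projection(1)[OF \<psi> minimal_projectionsD(3)] by (simp add: w)
  qed
  have sum_w: "(\<Sum>l\<in>?S. w l *\<^sub>R l c) = \<psi> c" if c: "c \<in> C" for c
  proof -
    have "(\<Sum>l\<in>?S. w l *\<^sub>R l c) = (\<Sum>p\<in>?M. w (?ch p) *\<^sub>R ?ch p c)"
      by (rule sum.reindex_bij_betw[OF bij, symmetric])
    also have "\<dots> = (\<Sum>p\<in>?M. \<psi> (c ** p))"
      by (intro sum.cong refl)
        (simp add: mult_minimal_projection[OF C _ c] state_cscale[OF \<psi>] w \<psi>p scaleR_conv_of_real)
    also have "\<dots> = \<psi> (c ** (\<Sum>p\<in>?M. p))"
      by (simp add: matrix_mult_sum_right state_sum[OF \<psi>])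
    finally show ?thesis
      by (simp add: sum_minimal_projections[OF C])
  qed
  \<comment> \<open>Total mass one is the formula \<open>sum_w\<close> taken at the identity
    matrix.\<close>
  have "complex_of_real (\<Sum>l\<in>?S. w l) = (\<Sum>l\<in>?S. w l *\<^sub>R l (mat 1))"
    by (simp add: scaleR_conv_of_real character_one[OF C])
  also have "\<dots> = 1"
    by (simp add: sum_w[OF context_one[OF C]] state_one[OF \<psi>])
  finally have "(\<Sum>l\<in>?S. w l) = 1"
    by (simp only: of_real_eq_1_iff)
  then have "prob_space (point_measure ?S w)"
    using fin w_nonneg
    by (intro prob_spaceI) (simp add: space_point_measure emeasure_point_measure_finite sum_ennreal)
  moreover have "has_bochner_integral (point_measure ?S w) (\<lambda>l. l c) (\<psi> c)" if "c \<in> C" for c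
    using sum_w[OF that] fin w_nonneg
    by (simp add: has_bochner_integral_iff integrable_point_measure_finite
        lebesgue_integral_point_measure_finite)
  moreover have "space (point_measure ?S w) = ?S"
    by (rule space_point_measure)
  moreover have "sets (point_measure ?S w) = sigma_sets ?S {U. openin (gelfand_topology C) U}"
    by (simp only: sets_point_measure sigma_sets_gelfand_topology[OF C])
  ultimately show ?thesis
    unfolding represents_state_def by blast
qed

lemma represents_state_riesz_measure:
  assumes "C \<in> contexts" "is_state \<psi>"
  shows "represents_state \<psi> C (riesz_measure \<psi> C)"
proof -
  have "riesz_measure \<psi> C = (THE M. represents_state \<psi> C M)"
    by (simp add: riesz_measure_def represents_state_def)
  moreover have "\<exists>!M. represents_state \<psi> C M"
    using represents_state_exists represents_state_unique assms by blast
  ultimately show ?thesis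
    by (simp add: theI')
qed


section \<open>Elementary propositions\<close>

text \<open>Each fibre is the support of a projection. Upward closure holds because inner
  daseinisation grows with the context: the approximation in \<open>D\<close> is still a candidate
  in the larger \<open>C\<close>, and a character with value 1 on a projection has value 1 on any
  larger one.\<close>

lemma Sigma_up_open_elementary_proposition:
  assumes a: "selfadjoint a"
  shows "Sigma_up_open [a \<in>\<in> \<Delta>]"
proof -
  let ?d = "\<delta>\<^sup>i (\<chi>\<^sub>s\<^sub>p \<Delta> a)"
  note p = is_projection_spectral_projection[OF a, of \<Delta>]
  have fib: "fibre [a \<in>\<in> \<Delta>] C = {l \<in> \<Sigma>\<^sub>G C. l (?d C) = 1}" if "C \<in> contexts" for C
    using that by (auto simp: elementary_proposition_def Sigma_up_def)
  show ?thesis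
    unfolding Sigma_up_open_def
  proof (intro conjI ballI impI)
    show "[a \<in>\<in> \<Delta>] \<subseteq> Sigma_up"
      by (auto simp: elementary_proposition_def)
    show "openin (gelfand_topology C) (fibre [a \<in>\<in> \<Delta>] C)" if "C \<in> contexts" for C
      unfolding fib[OF that] by (intro openin_projection_support inner_daseinisation_Proj that p)
    fix C D l l'
    assume D: "D \<in> contexts" and C: "C \<in> contexts" and l: "l \<in> fibre [a \<in>\<in> \<Delta>] D"
      and l': "l' \<in> \<Sigma>\<^sub>G C" and DC: "D \<subseteq> C \<and> restrict l' D = l"
    have dD: "?d D \<in> Proj D"
      by (rule inner_daseinisation_Proj[OF D p])
    then have dC: "?d D \<in> Proj C"
      using DC by (auto simp: Proj_def)
    have "?d D \<preceq> ?d C"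
      by (intro le_inner_daseinisation[OF C p dC] inner_daseinisation_le[OF D p])
    moreover have "l' (?d D) = 1"
      using l DC dD by (auto simp: fib[OF D] Proj_def)
    ultimately have "l' (?d C) = 1"
      using character_projection_mono[OF l' inner_daseinisation_Proj[OF C p] dC] by blast
    then show "l' \<in> fibre [a \<in>\<in> \<Delta>] C"
      using l' by (simp add: fib[OF C])
  qed
qed

lemma internal_valuation_meet:
  assumes \<psi>: "is_state \<psi>" and a: "selfadjoint a" and b: "selfadjoint b" and C: "C \<in> contexts"
  shows "complex_of_real
      (internal_valuation \<psi> (open_meet Sigma_up_topology [a \<in>\<in> \<Delta>] [b \<in>\<in> \<Gamma>]) C) =
    \<psi> (\<delta>\<^sup>i (\<chi>\<^sub>s\<^sub>p \<Delta> a) C ** \<delta>\<^sup>i (\<chi>\<^sub>s\<^sub>p \<Gamma> b) C)"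
proof -
  let ?d = "\<delta>\<^sup>i (\<chi>\<^sub>s\<^sub>p \<Delta> a) C" and ?e = "\<delta>\<^sup>i (\<chi>\<^sub>s\<^sub>p \<Gamma> b) C"
  have d: "?d \<in> Proj C" "?e \<in> Proj C"
    using a b C by (simp_all add: inner_daseinisation_Proj is_projection_spectral_projection)
  have "open_meet Sigma_up_topology [a \<in>\<in> \<Delta>] [b \<in>\<in> \<Gamma>] = [a \<in>\<in> \<Delta>] \<inter> [b \<in>\<in> \<Gamma>]"
    using a b
    by (intro open_meet_eq_Int) (simp_all add: openin_Sigma_up_topology Sigma_up_open_elementary_proposition)
  then have "fibre (open_meet Sigma_up_topology [a \<in>\<in> \<Delta>] [b \<in>\<in> \<Gamma>]) C =
      {l \<in> \<Sigma>\<^sub>G C. l ?d = 1 \<and> l ?e = 1}"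
    using C by (auto simp: elementary_proposition_def Sigma_up_def)
  \<comment> \<open>Since \<open>l ?d\<close> is 0 or 1, the product of the two values is 1 only if
    both are.\<close>
  also have "\<dots> = {l \<in> \<Sigma>\<^sub>G C. l (?d ** ?e) = 1}"
    using d gelfand_spectrumD(4)[of _ C ?d ?e] character_projection[OF _ d(1)]
    by (fastforce simp: Proj_def)
  finally show ?thesis
    unfolding internal_valuation_def
    using measure_projection_support[OF C represents_state_riesz_measure[OF C \<psi>] Proj_mult[OF C d]]
    by simp
qed

theorem proposition4p6:
  fixes \<psi> :: "'n::finite cmat \<Rightarrow> complex"
    and a\<^sub>1 a\<^sub>2 :: "'n cmat"
    and \<Delta>\<^sub>1 \<Delta>\<^sub>2 :: "real set"
    and C :: "'n cmat set"
  assumes "is_state \<psi>"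
    and "selfadjoint a\<^sub>1" and "selfadjoint a\<^sub>2"
    and "open \<Delta>\<^sub>1" and "open \<Delta>\<^sub>2"
    and "C \<in> contexts"
  shows "forces_valuation_one C \<psi> (open_meet Sigma_up_topology [a\<^sub>1 \<in>\<in> \<Delta>\<^sub>1] [a\<^sub>2 \<in>\<in> \<Delta>\<^sub>2]) \<longleftrightarrow>
    (\<exists>p\<in>Proj C. p \<preceq> \<chi>\<^sub>s\<^sub>p \<Delta>\<^sub>1 a\<^sub>1 \<and> p \<preceq> \<chi>\<^sub>s\<^sub>p \<Delta>\<^sub>2 a\<^sub>2 \<and> \<psi> p = 1)"
    (is "?forces \<longleftrightarrow> ?ex")
proof -
  note \<psi> = assms(1) and C = assms(6)
  let ?p = "\<chi>\<^sub>s\<^sub>p \<Delta>\<^sub>1 a\<^sub>1" and ?q = "\<chi>\<^sub>s\<^sub>p \<Delta>\<^sub>2 a\<^sub>2"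
  let ?d = "\<lambda>E. \<delta>\<^sup>i ?p E ** \<delta>\<^sup>i ?q E"
  have p: "is_projection ?p" and q: "is_projection ?q"
    using assms by (simp_all add: is_projection_spectral_projection)
  \<comment> \<open>The real equation is read in the complex numbers, where
    \<open>internal_valuation_meet\<close> evaluates it.\<close>
  have forces: "?forces \<longleftrightarrow> (\<forall>E\<in>contexts. C \<subseteq> E \<longrightarrow> \<psi> (?d E) = 1)"
    unfolding forces_valuation_one_def
    by (simp add: of_real_eq_1_iff[where 'a = complex, symmetric]
        internal_valuation_meet[OF assms(1-3)] del: of_real_eq_1_iff)
  have le_trans: "r \<preceq> t" if "r \<preceq> s" "s \<preceq> t" "is_projection r" "is_projection s" "is_projection t"
    for r s t :: "'n cmat"
    using that by (simp add: projection_le_iff_range)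
  show ?thesis
  proof
    assume ?forces
    \<comment> \<open>Forcing is evaluated at the stage \<open>C\<close> itself, and
      \<open>?d C\<close> becomes the witness.\<close>
    then have "\<psi> (?d C) = 1"
      using forces C by blast
    moreover have d: "\<delta>\<^sup>i ?p C \<in> Proj C" "\<delta>\<^sup>i ?q C \<in> Proj C"
      using C p q by (simp_all add: inner_daseinisation_Proj)
    have "?d C \<preceq> ?p" "?d C \<preceq> ?q"
      using le_trans Proj_mult_le[OF C d] inner_daseinisation_le[OF C] Proj_mult[OF C d] p q d
        Proj_is_projection by metis+
    ultimately show ?ex
      using Proj_mult[OF C d] by blast
  next
    assume ?ex
    then obtain r where r: "r \<in> Proj C" "r \<preceq> ?p" "r \<preceq> ?q" "\<psi> r = 1"
      by blast
    have "\<psi> (?d E) = 1" if E: "E \<in> contexts" "C \<subseteq> E" for E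
    proof -
      have d: "\<delta>\<^sup>i ?p E \<in> Proj E" "\<delta>\<^sup>i ?q E \<in> Proj E"
        using E p q by (simp_all add: inner_daseinisation_Proj)
      \<comment> \<open>A projection of \<open>C\<close> remains one of \<open>E\<close>, so
        \<open>r\<close> is among the candidates whose supremum is the daseinisation in
        \<open>E\<close>.\<close>
      have rE: "r \<in> Proj E"
        using r(1) E(2) by (auto simp: Proj_def)
      then have "\<delta>\<^sup>i ?p E ** r = r" "\<delta>\<^sup>i ?q E ** r = r"
        using le_inner_daseinisation[OF E(1) p rE r(2)] le_inner_daseinisation[OF E(1) q rE r(3)] d
        by (simp_all add: projection_le_iff Proj_is_projection)
      then have "?d E ** r = r"
        by (simp flip: matrix_mul_assoc)
      moreover have dE: "is_projection (?d E)"
        using Proj_mult[OF E(1) d] by (rule Proj_is_projection)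
      ultimately have "r \<preceq> ?d E"
        using rE by (simp add: projection_le_iff Proj_is_projection)
      \<comment> \<open>Monotonicity of the state squeezes the value at \<open>?d E\<close> between
        those at \<open>r\<close> and at the identity, both equal to 1.\<close>
      then have "1 \<le> Re (\<psi> (?d E))"
        using state_projection_mono[OF \<psi> dE Proj_is_projection[OF rE]] r(4) by simp
      moreover have "?d E \<preceq> mat 1"
        using dE by (simp add: projection_le_iff)
      then have "Re (\<psi> (?d E)) \<le> 1"
        using state_projection_mono[OF \<psi> is_projection_one dE] state_one[OF \<psi>] by simp
      ultimately have "Re (\<psi> (?d E)) = 1"
        by simp
      then show ?thesis
        using state_projection(2)[OF \<psi> dE] by (metis of_real_1)
    qed
    then show ?forces
      using forces by blast
  qed
qed

end
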